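(* Let $(\boldsymbol{x},\boldsymbol{n},\boldsymbol{s}):U\to\mathbb{R}^3\times\Delta$ be a framed surface with basic invariants $a_i,b_i,e_i,f_i,g_i$ ($i=1,2$). Then $(\boldsymbol{x},\boldsymbol{n},\boldsymbol{s})$ is an $(\boldsymbol{s},\overline{\boldsymbol{n}})$-Bertrand framed surface if and only if $b_1(u,v)g_2(u,v)-b_2(u,v)g_1(u,v)=0$ for all $(u,v)\in U$ and the function $\lambda:U\to\mathbb{R}$ is given by $$\lambda(u,v)=-\left(\int_{u_0}^{u}a_1(u,v)\,du+\int_{v_0}^{v}a_2(u_0,v)\,dv\right)+c$$ for a point $(u_0,v_0)\in U$ and a constant $c\in\mathbb{R}$ with $\lambda\not\equiv0$. Precisely: for a smooth function $\lambda:U\to\mathbb{R}$ with $\lambda\not\equiv0$, there exists a framed surface $(\overline{\boldsymbol{x}},\overline{\boldsymbol{n}},\overline{\boldsymbol{s}}):U\to\mathbb{R}^3\times\Delta$ with $\overline{\boldsymbol{x}}=\boldsymbol{x}+\lambda\boldsymbol{s}$ and $\overline{\boldsymbol{n}}=\boldsymbol{s}$ if and only if $b_1g_2-b_2g_1=0$ on $U$ and $\lambda$ has the displayed form for some $(u_0,v_0)\in U$ and $c\in\mathbb{R}$; and $(\boldsymbol{x},\boldsymbol{n},\boldsymbol{s})$ is an $(\boldsymbol{s},\overline{\boldsymbol{n}})$-Bertrand framed surface if and only if $b_1g_2-b_2g_1=0$ on $U$ and there exists such a $\lambda\not\equiv0$.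
   Context: All maps are $C^\infty$. $U\subset\mathbb{R}^2$ is a simply connected domain with coordinates $(u,v)$, $S^2$ is the unit sphere in $\mathbb{R}^3$, and $\Delta=\{(\boldsymbol{a},\boldsymbol{b})\in S^2\times S^2 : \boldsymbol{a}\cdot\boldsymbol{b}=0\}$. A framed surface is a smooth map $(\boldsymbol{x},\boldsymbol{n},\boldsymbol{s}):U\to\mathbb{R}^3\times\Delta$ with $\boldsymbol{x}_u\cdot\boldsymbol{n}=\boldsymbol{x}_v\cdot\boldsymbol{n}=0$ on $U$. Put $\boldsymbol{t}=\boldsymbol{n}\times\boldsymbol{s}$. Its basic invariants are the smooth functions $a_i,b_i,e_i,f_i,g_i:U\to\mathbb{R}$ ($i=1,2$) determined by $\boldsymbol{x}_u=a_1\boldsymbol{s}+b_1\boldsymbol{t}$, $\boldsymbol{n}_u=e_1\boldsymbol{s}+f_1\boldsymbol{t}$, $\boldsymbol{s}_u=-e_1\boldsymbol{n}+g_1\boldsymbol{t}$, $\boldsymbol{t}_u=-f_1\boldsymbol{n}-g_1\boldsymbol{s}$, and the same equations with $\partial_v$ in place of $\partial_u$ and index $2$ in place of $1$. The integrability condition $\boldsymbol{x}_{uv}=\boldsymbol{x}_{vu}$ gives in particular $(a_1)_v-(a_2)_u=b_1g_2-b_2g_1$. The displayed expression in the claim is (minus) the integral of the 1-form $a_1du+a_2dv$ along the path from $(u_0,v_0)$ to $(u_0,v)$ to $(u,v)$; if this path is not contained in $U$, it is read as the integral of this 1-form (closed when $b_1g_2-b_2g_1=0$) along any path in $U$ from $(u_0,v_0)$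 to $(u,v)$. For a smooth $\lambda:U\to\mathbb{R}$, $\lambda\not\equiv0$ means that $\{(u,v)\in U:\lambda(u,v)\neq0\}$ is dense in $U$. Two framed surfaces $(\boldsymbol{x},\boldsymbol{n},\boldsymbol{s}),(\overline{\boldsymbol{x}},\overline{\boldsymbol{n}},\overline{\boldsymbol{s}}):U\to\mathbb{R}^3\times\Delta$ are $(\boldsymbol{s},\overline{\boldsymbol{n}})$-mates if there is a smooth $\lambda:U\to\mathbb{R}$ with $\lambda\not\equiv0$ such that $\overline{\boldsymbol{x}}=\boldsymbol{x}+\lambda\boldsymbol{s}$ and $\boldsymbol{s}=\overline{\boldsymbol{n}}$ on $U$. $(\boldsymbol{x},\boldsymbol{n},\boldsymbol{s})$ is an $(\boldsymbol{s},\overline{\boldsymbol{n}})$-Bertrand framed surface if there is a framed surface $(\overline{\boldsymbol{x}},\overline{\boldsymbol{n}},\overline{\boldsymbol{s}}):U\to\mathbb{R}^3\times\Delta$ such that the two are $(\boldsymbol{s},\overline{\boldsymbol{n}})$-mates. *)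

theory Defs
  imports "HOL-Analysis.Analysis"
begin

text \<open>
  Functions on a domain \<open>U\<close> of the plane are total functions on \<^typ>\<open>real \<times> real\<close>, of which only
  the values on \<open>U\<close> matter.  The definitions below are meant for open \<open>U\<close>.
\<close>

primrec Ck_on :: "nat \<Rightarrow> 'a::real_normed_vector set \<Rightarrow> ('a \<Rightarrow> 'b::real_normed_vector) \<Rightarrow> bool" where
  "Ck_on 0 U f \<longleftrightarrow> continuous_on U f"
| "Ck_on (Suc k) U f \<longleftrightarrow>
     (\<forall>p\<in>U. f differentiable (at p)) \<and> (\<forall>h. Ck_on k U (\<lambda>p. frechet_derivative f (at p) h))"

definition smooth_on :: "'a::real_normed_vector set \<Rightarrow> ('a \<Rightarrow> 'b::real_normed_vector) \<Rightarrow> bool" where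
  "smooth_on U f \<longleftrightarrow> (\<forall>k. Ck_on k U f)"

definition partial_u :: "(real \<times> real \<Rightarrow> 'b::real_normed_vector) \<Rightarrow> real \<times> real \<Rightarrow> 'b" where
  "partial_u f p = vector_derivative (\<lambda>r. f (r, snd p)) (at (fst p))"

definition partial_v :: "(real \<times> real \<Rightarrow> 'b::real_normed_vector) \<Rightarrow> real \<times> real \<Rightarrow> 'b" where
  "partial_v f p = vector_derivative (\<lambda>r. f (fst p, r)) (at (snd p))"

definition Delta :: "((real^3) \<times> (real^3)) set" where
  "Delta = {(a, b). a \<in> sphere 0 1 \<and> b \<in> sphere 0 1 \<and> a \<bullet> b = 0}"

definition framed_surface ::
  "(real \<times> real) set \<Rightarrow> (real \<times> real \<Rightarrow> real^3) \<Rightarrow> (real \<times> real \<Rightarrow> real^3) \<Rightarrow>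
   (real \<times> real \<Rightarrow> real^3) \<Rightarrow> bool" where
  "framed_surface U x n s \<longleftrightarrow>
     smooth_on U x \<and> smooth_on U n \<and> smooth_on U s \<and>
     (\<forall>p\<in>U. (n p, s p) \<in> Delta) \<and>
     (\<forall>p\<in>U. partial_u x p \<bullet> n p = 0 \<and> partial_v x p \<bullet> n p = 0)"

text \<open>
  The structure equations in one coordinate direction; \<open>D\<close> is \<^const>\<open>partial_u\<close> for the
  invariants with index 1 and \<^const>\<open>partial_v\<close> for those with index 2.
\<close>

definition frame_equations ::
  "((real \<times> real \<Rightarrow> real^3) \<Rightarrow> real \<times> real \<Rightarrow> real^3) \<Rightarrow> (real \<times> real) set \<Rightarrow>
   (real \<times> real \<Rightarrow> real^3) \<Rightarrow> (real \<times> real \<Rightarrow> real^3) \<Rightarrow> (real \<times> real \<Rightarrow> real^3) \<Rightarrow>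
   (real \<times> real \<Rightarrow> real) \<Rightarrow> (real \<times> real \<Rightarrow> real) \<Rightarrow> (real \<times> real \<Rightarrow> real) \<Rightarrow>
   (real \<times> real \<Rightarrow> real) \<Rightarrow> (real \<times> real \<Rightarrow> real) \<Rightarrow> bool" where
  "frame_equations D U x n s a b e f g \<longleftrightarrow>
     (let t = (\<lambda>p. cross3 (n p) (s p)) in
      \<forall>p\<in>U. D x p = a p *\<^sub>R s p + b p *\<^sub>R t p \<and>
            D n p = e p *\<^sub>R s p + f p *\<^sub>R t p \<and>
            D s p = - e p *\<^sub>R n p + g p *\<^sub>R t p \<and>
            D t p = - f p *\<^sub>R n p - g p *\<^sub>R s p)"

definition basic_invariants ::
  "(real \<times> real) set \<Rightarrow>
   (real \<times> real \<Rightarrow> real^3) \<Rightarrow> (real \<times> real \<Rightarrow> real^3) \<Rightarrow> (real \<times> real \<Rightarrow> real^3) \<Rightarrow>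
   (real \<times> real \<Rightarrow> real) \<Rightarrow> (real \<times> real \<Rightarrow> real) \<Rightarrow> (real \<times> real \<Rightarrow> real) \<Rightarrow>
   (real \<times> real \<Rightarrow> real) \<Rightarrow> (real \<times> real \<Rightarrow> real) \<Rightarrow>
   (real \<times> real \<Rightarrow> real) \<Rightarrow> (real \<times> real \<Rightarrow> real) \<Rightarrow> (real \<times> real \<Rightarrow> real) \<Rightarrow>
   (real \<times> real \<Rightarrow> real) \<Rightarrow> (real \<times> real \<Rightarrow> real) \<Rightarrow> bool" where
  "basic_invariants U x n s a1 b1 e1 f1 g1 a2 b2 e2 f2 g2 \<longleftrightarrow>
     (\<forall>h \<in> {a1, b1, e1, f1, g1, a2, b2, e2, f2, g2}. smooth_on U h) \<and>
     frame_equations partial_u U x n s a1 b1 e1 f1 g1 \<and>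
     frame_equations partial_v U x n s a2 b2 e2 f2 g2"

text \<open>\<open>\<lambda> \<notequiv> 0\<close> means non-vanishing on a dense subset of \<open>U\<close>, not merely somewhere.\<close>

definition not_equiv_zero :: "(real \<times> real) set \<Rightarrow> (real \<times> real \<Rightarrow> real) \<Rightarrow> bool" where
  "not_equiv_zero U l \<longleftrightarrow> U \<subseteq> closure {p \<in> U. l p \<noteq> 0}"

definition s_n_mates ::
  "(real \<times> real) set \<Rightarrow>
   (real \<times> real \<Rightarrow> real^3) \<Rightarrow> (real \<times> real \<Rightarrow> real^3) \<Rightarrow> (real \<times> real \<Rightarrow> real^3) \<Rightarrow>
   (real \<times> real \<Rightarrow> real^3) \<Rightarrow> (real \<times> real \<Rightarrow> real^3) \<Rightarrow> (real \<times> real \<Rightarrow> real^3) \<Rightarrow> bool" where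
  "s_n_mates U x n s x' n' s' \<longleftrightarrow>
     framed_surface U x n s \<and> framed_surface U x' n' s' \<and>
     (\<exists>l. smooth_on U l \<and> not_equiv_zero U l \<and>
          (\<forall>p\<in>U. x' p = x p + l p *\<^sub>R s p \<and> s p = n' p))"

definition s_n_Bertrand ::
  "(real \<times> real) set \<Rightarrow>
   (real \<times> real \<Rightarrow> real^3) \<Rightarrow> (real \<times> real \<Rightarrow> real^3) \<Rightarrow> (real \<times> real \<Rightarrow> real^3) \<Rightarrow> bool" where
  "s_n_Bertrand U x n s \<longleftrightarrow>
     (\<exists>x' n' s'. framed_surface U x' n' s' \<and> s_n_mates U x n s x' n' s')"

text \<open>The integral of the 1-form \<open>a1 du + a2 dv\<close> along a path.\<close>

definition line_integral ::
  "(real \<times> real \<Rightarrow> real) \<Rightarrow> (real \<times> real \<Rightarrow> real) \<Rightarrow> (real \<Rightarrow> real \<times> real) \<Rightarrow> real" where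
  "line_integral a1 a2 \<gamma> =
     integral {0..1} (\<lambda>r. a1 (\<gamma> r) * fst (vector_derivative \<gamma> (at r)) +
                          a2 (\<gamma> r) * snd (vector_derivative \<gamma> (at r)))"

text \<open>
  \<open>has_integral_form U a1 a2 u0 v0 c l\<close> says that
  \<open>l(u,v) = - (\<integral>\<^sub>u\<^sub>0\<^sup>u a1(r,v) dr + \<integral>\<^sub>v\<^sub>0\<^sup>v a2(u0,r) dr) + c\<close> on \<open>U\<close>.  Where the path
  from \<open>(u0,v0)\<close> via \<open>(u0,v)\<close> to \<open>(u,v)\<close> leaves \<open>U\<close>, the expression in parentheses stands for the
  integral of \<open>a1 du + a2 dv\<close> along any path in \<open>U\<close> from \<open>(u0,v0)\<close> to \<open>(u,v)\<close>.  Here paths are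
  piecewise \<open>C\<^sup>1\<close> (\<^const>\<open>valid_path\<close>), and \<open>LBINT\<close> is the oriented integral, so
  \<open>u < u0\<close> and \<open>v < v0\<close> are allowed.
\<close>

definition has_integral_form ::
  "(real \<times> real) set \<Rightarrow> (real \<times> real \<Rightarrow> real) \<Rightarrow> (real \<times> real \<Rightarrow> real) \<Rightarrow> real \<Rightarrow> real \<Rightarrow> real \<Rightarrow>
   (real \<times> real \<Rightarrow> real) \<Rightarrow> bool" where
  "has_integral_form U a1 a2 u0 v0 c l \<longleftrightarrow>
     (\<forall>u v. (u, v) \<in> U \<longrightarrow>
        (if closed_segment (u0, v0) (u0, v) \<union> closed_segment (u0, v) (u, v) \<subseteq> U
         then l (u, v) = - ((LBINT r=u0..u. a1 (r, v)) + (LBINT r=v0..v. a2 (u0, r))) + c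
         else \<forall>\<gamma>. valid_path \<gamma> \<and> path_image \<gamma> \<subseteq> U \<and>
                  pathstart \<gamma> = (u0, v0) \<and> pathfinish \<gamma> = (u, v) \<longrightarrow>
                  l (u, v) = - line_integral a1 a2 \<gamma> + c))"

end

theory Submission
  imports Defs
begin

text \<open>
  A surface \<open>y = x + l s\<close> has \<open>s\<close> as a normal vector iff its partial derivatives are orthogonal to
  \<open>s\<close>.  Since \<open>s\<close> is a unit vector, its derivatives contribute nothing in the direction \<open>s\<close>, and the
  \<open>s\<close>-components of \<open>y\<^sub>u\<close> and \<open>y\<^sub>v\<close> are \<open>a1 + l\<^sub>u\<close> and \<open>a2 + l\<^sub>v\<close>.  As the remaining frame vector of
  the mate may be taken to be \<open>n\<close>, a mate with displacement \<open>l\<close> exists iff \<open>dl = - (a1 du + a2 dv)\<close>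
  (\<open>framed_surface_mate_iff\<close>).  Everything else concerns this equation.

  If it holds, then the form \<open>a1 du + a2 dv\<close> is closed, and \<open>x\<^sub>u\<^sub>v = x\<^sub>v\<^sub>u\<close> says that the failure of
  closedness is \<open>b1 g2 - b2 g1\<close> (\<open>integrability_condition\<close>); so this function vanishes.  The integral
  formula for \<open>l\<close> is the fundamental theorem of calculus along paths
  (\<open>has_integral_form_of_primitive\<close>).

  The converse, \<open>has_integral_form_imp_derivative\<close>, recovers \<open>dl\<close> from the integral formula when the
  form is closed.  Let \<open>R\<close> be the open set of those points of \<open>U\<close> whose L-shaped path from \<open>(u0, v0)\<close>
  stays in \<open>U\<close>.  On \<open>R\<close> the formula gives \<open>l\<^sub>u = - a1\<close> at once; by closedness and \<open>l\<^sub>u\<^sub>v = l\<^sub>v\<^sub>u\<close> the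
  function \<open>l\<^sub>v + a2\<close> is then constant along the horizontal leg of each L-shaped path, and it is zero at
  the corner.  Off \<open>R\<close>, the formula holds for all paths, so that at an interior point of \<open>U - R\<close> one can
  differentiate it along a short segment appended to a fixed path.  The points of \<open>R\<close> and the
  interior points of \<open>U - R\<close> are dense in \<open>U\<close>, and \<open>dl\<close> is continuous, hence the equation holds
  everywhere.

  Partial derivatives are handled throughout as values of the Frechet derivative at \<open>(1, 0)\<close> and
  \<open>(0, 1)\<close>, so that the two coordinate directions need no separate calculus.
\<close>

section \<open>Smooth functions on an open set\<close>

text \<open>
  Derivatives at a point of an open set depend only on the values on that set; this is what makes
  the smoothness of a function that is prescribed only on \<open>U\<close> meaningful.
\<close>
lemma Ck_on_cong:
  assumes "open U" "Ck_on k U f" "\<And>p. p \<in> U \<Longrightarrow> f p = g p"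
  shows "Ck_on k U g"
  using assms(2,3)
proof (induction k arbitrary: f g)
  case 0
  then show ?case by (simp cong: continuous_on_cong)
next
  case (Suc k)
  have D: "(g has_derivative frechet_derivative f (at p)) (at p)" if "p \<in> U" for p
  proof (rule has_derivative_transform_within_open[OF _ \<open>open U\<close> that])
    show "(f has_derivative frechet_derivative f (at p)) (at p)"
      using Suc.prems(1) that by (simp flip: frechet_derivative_works)
  qed (use Suc.prems(2) in simp)
  have "Ck_on k U (\<lambda>p. frechet_derivative g (at p) h)" for h
    using Suc.IH[of "\<lambda>p. frechet_derivative f (at p) h"] Suc.prems(1)
    by (simp add: frechet_derivative_at[OF D, symmetric])
  then show ?case
    using D by (auto simp: differentiable_def)
qed

lemma smooth_on_frechet_derivative:
  assumes "smooth_on U f"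
  shows "smooth_on U (\<lambda>p. frechet_derivative f (at p) h)"
proof -
  have "Ck_on (Suc k) U f" for k
    using assms unfolding smooth_on_def by blast
  then show ?thesis by (simp add: smooth_on_def)
qed

lemma smooth_on_differentiable:
  assumes "smooth_on U f" "p \<in> U"
  shows "f differentiable (at p)"
proof -
  have "Ck_on (Suc 0) U f"
    using assms unfolding smooth_on_def by blast
  with assms(2) show ?thesis by simp
qed

lemma smooth_on_has_derivative:
  assumes "smooth_on U f" "p \<in> U"
  shows "(f has_derivative frechet_derivative f (at p)) (at p)"
  using smooth_on_differentiable[OF assms] frechet_derivative_works by blast

lemma smooth_on_continuous_on:
  assumes "smooth_on U f"
  shows "continuous_on U f"
proof -
  have "Ck_on 0 U f"
    using assms unfolding smooth_on_def by blast
  then show ?thesis by simp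
qed

lemma smooth_on_const: "smooth_on U (\<lambda>p. c)"
proof -
  have "Ck_on k U (\<lambda>p. c)" for k and c :: 'b
    by (induction k arbitrary: c) auto
  then show ?thesis by (simp add: smooth_on_def)
qed

lemma Ck_on_add:
  assumes "open U" "Ck_on k U f" "Ck_on k U g"
  shows "Ck_on k U (\<lambda>p. f p + g p)"
  using assms(2,3)
proof (induction k arbitrary: f g)
  case 0
  then show ?case by (auto intro!: continuous_intros)
next
  case (Suc k)
  have D: "((\<lambda>p. f p + g p) has_derivative
      (\<lambda>h. frechet_derivative f (at p) h + frechet_derivative g (at p) h)) (at p)" if "p \<in> U" for p
    using Suc.prems that by (intro has_derivative_add) (simp_all flip: frechet_derivative_works)
  have "Ck_on k U (\<lambda>p. frechet_derivative (\<lambda>p. f p + g p) (at p) h)" for h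
  proof (rule Ck_on_cong[OF \<open>open U\<close>])
    show "Ck_on k U (\<lambda>p. frechet_derivative f (at p) h + frechet_derivative g (at p) h)"
      using Suc.prems by (intro Suc.IH) auto
  qed (simp add: frechet_derivative_at[OF D, symmetric])
  then show ?case
    using D by (auto simp: differentiable_def)
qed

lemma smooth_on_add:
  assumes "open U" "smooth_on U f" "smooth_on U g"
  shows "smooth_on U (\<lambda>p. f p + g p)"
  unfolding smooth_on_def
proof
  show "Ck_on k U (\<lambda>p. f p + g p)" for k
    using assms(2,3) by (intro Ck_on_add[OF assms(1)]) (simp_all add: smooth_on_def)
qed

text \<open>
  By the product rule, a directional derivative of \<open>B (f p) (g p)\<close> is a sum of two expressions of
  the same kind in smooth functions.  So the induction is over the order of differentiability, for
  all smooth \<open>f\<close> and \<open>g\<close> at once.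
\<close>
lemma smooth_on_bilinear:
  assumes "bounded_bilinear B" "open U" "smooth_on U f" "smooth_on U g"
  shows "smooth_on U (\<lambda>p. B (f p) (g p))"
proof -
  have "Ck_on k U (\<lambda>p. B (f p) (g p))" if "smooth_on U f" "smooth_on U g" for k f g
    using that
  proof (induction k arbitrary: f g)
    case 0
    then show ?case
      by (simp add: bounded_bilinear.continuous_on[OF assms(1)] smooth_on_continuous_on)
  next
    case (Suc k)
    have D: "((\<lambda>p. B (f p) (g p)) has_derivative
        (\<lambda>h. B (f p) (frechet_derivative g (at p) h) + B (frechet_derivative f (at p) h) (g p))) (at p)"
      if "p \<in> U" for p
      using Suc.prems that by (intro bounded_bilinear.FDERIV[OF assms(1)] smooth_on_has_derivative)
    have "Ck_on k U (\<lambda>p. frechet_derivative (\<lambda>p. B (f p) (g p)) (at p) h)" for h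
    proof (rule Ck_on_cong[OF \<open>open U\<close>])
      show "Ck_on k U (\<lambda>p. B (f p) (frechet_derivative g (at p) h) +
          B (frechet_derivative f (at p) h) (g p))"
        using Suc.prems by (intro Ck_on_add[OF \<open>open U\<close>] Suc.IH smooth_on_frechet_derivative)
    qed (simp add: frechet_derivative_at[OF D, symmetric])
    then show ?case
      using D by (auto simp: differentiable_def)
  qed
  with assms show ?thesis by (simp add: smooth_on_def)
qed

lemma smooth_on_line_derivative:
  assumes "smooth_on U f" "p + r *\<^sub>R e \<in> U"
  shows "((\<lambda>r. f (p + r *\<^sub>R e)) has_vector_derivative
    frechet_derivative f (at (p + r *\<^sub>R e)) e) (at r)"
proof -
  have "((\<lambda>r. p + r *\<^sub>R e) has_vector_derivative e) (at r)"
    by (auto intro!: derivative_eq_intros)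
  from vector_derivative_diff_chain_within[OF this, of f, unfolded o_def]
    smooth_on_has_derivative[OF assms]
  show ?thesis
    by (meson has_derivative_at_withinI)
qed

lemma frechet_derivative_cong:
  assumes "open U" "p \<in> U" "\<And>q. q \<in> U \<Longrightarrow> f q = g q"
  shows "frechet_derivative f (at p) = frechet_derivative g (at p)"
proof -
  have "(f has_derivative D) (at p) \<longleftrightarrow> (g has_derivative D) (at p)" for D
    using assms has_derivative_transform_within_open[of f D p UNIV U g]
      has_derivative_transform_within_open[of g D p UNIV U f] by auto
  then show ?thesis
    unfolding frechet_derivative_def by simp
qed

lemma frechet_derivative_bilinear:
  assumes "bounded_bilinear B" "smooth_on U f" "smooth_on U g" "p \<in> U"
  shows "frechet_derivative (\<lambda>q. B (f q) (g q)) (at p) e =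
    B (f p) (frechet_derivative g (at p) e) + B (frechet_derivative f (at p) e) (g p)"
  by (rule fun_cong[OF frechet_derivative_at[OF bounded_bilinear.FDERIV[OF assms(1)
      smooth_on_has_derivative[OF assms(2,4)] smooth_on_has_derivative[OF assms(3,4)]], symmetric]])

section \<open>Symmetry of second derivatives\<close>

text \<open>
  The second difference of \<open>f\<close> over a small parallelogram spanned by \<open>h d\<close> and \<open>h e\<close> is symmetric in
  \<open>d\<close> and \<open>e\<close>.  Two applications of the mean value theorem write it as \<open>h\<^sup>2\<close> times the mixed second
  derivative, taken in either order, at some point close to \<open>p\<close>.  Continuity lets \<open>h\<close> tend to 0.
\<close>
lemma second_derivative_symmetric_real:
  fixes f :: "'a::real_normed_vector \<Rightarrow> real"
  assumes "open U" and f: "smooth_on U f" and "p \<in> U"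
  shows "frechet_derivative (\<lambda>q. frechet_derivative f (at q) d) (at p) e =
    frechet_derivative (\<lambda>q. frechet_derivative f (at q) e) (at p) d"
proof -
  let ?D = "\<lambda>d e q. frechet_derivative (\<lambda>q. frechet_derivative f (at q) d) (at q) e"
  have line: "((\<lambda>r. g (q + r *\<^sub>R e)) has_real_derivative frechet_derivative g (at (q + r *\<^sub>R e)) e) (at r)"
    if "smooth_on U g" "q + r *\<^sub>R e \<in> U" for g :: "'a \<Rightarrow> real" and q r e
    using smooth_on_line_derivative[OF that] by (simp add: has_real_derivative_iff_has_vector_derivative)
  have mean: "\<exists>q\<in>ball p \<delta>. f (p + h *\<^sub>R d + h *\<^sub>R e) - f (p + h *\<^sub>R d) - f (p + h *\<^sub>R e) + f p = h * h * ?D d e q"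
    if "0 < h" "h * (norm d + norm e) < \<delta>" "ball p \<delta> \<subseteq> U" for h \<delta> d e
  proof -
    have B: "p + i *\<^sub>R d + j *\<^sub>R e \<in> ball p \<delta>" if "0 \<le> i" "i \<le> h" "0 \<le> j" "j \<le> h" for i j
    proof -
      have "norm (i *\<^sub>R d + j *\<^sub>R e) \<le> i * norm d + j * norm e"
        using that by (metis norm_triangle_ineq norm_scaleR abs_of_nonneg)
      also have "\<dots> \<le> h * (norm d + norm e)"
        using that by (simp add: distrib_left add_mono mult_right_mono)
      finally have "norm (i *\<^sub>R d + j *\<^sub>R e) < \<delta>"
        using \<open>h * (norm d + norm e) < \<delta>\<close> by simp
      moreover have "dist p (p + z) = norm z" for z
        by (simp add: dist_norm)
      ultimately show ?thesis
        by (simp add: add.assoc)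
    qed
    define \<phi> where "\<phi> = (\<lambda>i. f (p + h *\<^sub>R e + i *\<^sub>R d) - f (p + i *\<^sub>R d))"
    have "\<exists>i. 0 < i \<and> i < h \<and> \<phi> h - \<phi> 0 = (h - 0) *
       (frechet_derivative f (at (p + h *\<^sub>R e + i *\<^sub>R d)) d - frechet_derivative f (at (p + i *\<^sub>R d)) d)"
    proof (rule MVT2[OF \<open>0 < h\<close>])
      fix i assume "0 \<le> i" "i \<le> h"
      then have "p + h *\<^sub>R e + i *\<^sub>R d \<in> U" "p + i *\<^sub>R d \<in> U"
        using B[of i h] B[of i 0] that by (auto simp: algebra_simps)
      then show "(\<phi> has_real_derivative frechet_derivative f (at (p + h *\<^sub>R e + i *\<^sub>R d)) d -
          frechet_derivative f (at (p + i *\<^sub>R d)) d) (at i)"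
        unfolding \<phi>_def using f
        by (intro DERIV_diff line)
    qed
    then obtain i where i: "0 < i" "i < h" "\<phi> h - \<phi> 0 = h *
       (frechet_derivative f (at (p + i *\<^sub>R d + h *\<^sub>R e)) d - frechet_derivative f (at (p + i *\<^sub>R d)) d)"
      by (auto simp: algebra_simps)
    have "\<exists>j. 0 < j \<and> j < h \<and> frechet_derivative f (at (p + i *\<^sub>R d + h *\<^sub>R e)) d -
        frechet_derivative f (at (p + i *\<^sub>R d + 0 *\<^sub>R e)) d = (h - 0) * ?D d e (p + i *\<^sub>R d + j *\<^sub>R e)"
    proof (rule MVT2[OF \<open>0 < h\<close>])
      fix j assume "0 \<le> j" "j \<le> h"
      then have "p + i *\<^sub>R d + j *\<^sub>R e \<in> U"
        using B[of i j] i that by auto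
      then show "((\<lambda>j. frechet_derivative f (at (p + i *\<^sub>R d + j *\<^sub>R e)) d) has_real_derivative
          ?D d e (p + i *\<^sub>R d + j *\<^sub>R e)) (at j)"
        using smooth_on_frechet_derivative[OF f, of d]
        by (intro line)
    qed
    then obtain j where "0 < j" "j < h" "\<phi> h - \<phi> 0 = h * h * ?D d e (p + i *\<^sub>R d + j *\<^sub>R e)"
      using i by auto
    then show ?thesis
      using B[of i j] i by (intro bexI[of _ "p + i *\<^sub>R d + j *\<^sub>R e"]) (auto simp: \<phi>_def algebra_simps)
  qed
  have "\<bar>?D d e p - ?D e d p\<bar> < \<epsilon>" if "0 < \<epsilon>" for \<epsilon>
  proof -
    have ev: "\<forall>\<^sub>F q in nhds p. dist (?D d e q) (?D d e p) < \<epsilon> / 2" for d e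
    proof -
      have "isCont (?D d e) p"
        using smooth_on_has_derivative[OF smooth_on_frechet_derivative[OF smooth_on_frechet_derivative[OF f]] \<open>p \<in> U\<close>]
          has_derivative_continuous by blast
      then show ?thesis
        using \<open>0 < \<epsilon>\<close> unfolding continuous_at_eps_delta eventually_nhds_metric
        by (metis half_gt_zero)
    qed
    have "\<forall>\<^sub>F q in nhds p. q \<in> U \<and> dist (?D d e q) (?D d e p) < \<epsilon> / 2 \<and> dist (?D e d q) (?D e d p) < \<epsilon> / 2"
      using eventually_nhds_in_open[OF \<open>open U\<close> \<open>p \<in> U\<close>] ev by (intro eventually_conj)
    then obtain \<delta> where \<delta>: "0 < \<delta>" "\<And>q. q \<in> ball p \<delta> \<Longrightarrow> q \<in> U \<and>
        dist (?D d e q) (?D d e p) < \<epsilon> / 2 \<and> dist (?D e d q) (?D e d p) < \<epsilon> / 2"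
      unfolding eventually_nhds_metric by (metis mem_ball dist_commute)
    \<comment> \<open>The added 1 only keeps the denominator positive when \<open>d\<close> and \<open>e\<close> are both zero.\<close>
    define h where "h = \<delta> / (norm d + norm e + 1)"
    have nz: "norm d + norm e + 1 > 0"
      by (simp add: add_nonneg_pos)
    have h: "0 < h" "h * (norm d + norm e) < \<delta>"
      using \<delta>(1) nz by (auto simp: h_def divide_simps)
    obtain q q' where q: "q \<in> ball p \<delta>" "q' \<in> ball p \<delta>" "h * h * ?D d e q = h * h * ?D e d q'"
      using mean[of h d e \<delta>] mean[of h e d \<delta>] h \<delta> by (force simp: algebra_simps)
    then have "?D d e q = ?D e d q'"
      using h by simp
    moreover have "\<bar>?D d e q - ?D d e p\<bar> < \<epsilon> / 2" "\<bar>?D e d q' - ?D e d p\<bar> < \<epsilon> / 2"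
      using \<delta>(2)[OF q(1)] \<delta>(2)[OF q(2)] by (simp_all only: dist_real_def)
    ultimately show ?thesis
      by linarith
  qed
  from this[of "\<bar>?D d e p - ?D e d p\<bar>"] show ?thesis
    by auto
qed

text \<open>
  Reduction to the real-valued case by testing against every vector \<open>w\<close>.
\<close>
lemma second_derivative_symmetric:
  fixes f :: "'a::real_normed_vector \<Rightarrow> 'b::real_inner"
  assumes "open U" and f: "smooth_on U f" and "p \<in> U"
  shows "frechet_derivative (\<lambda>q. frechet_derivative f (at q) d) (at p) e =
    frechet_derivative (\<lambda>q. frechet_derivative f (at q) e) (at p) d"
proof -
  let ?D = "\<lambda>d e. frechet_derivative (\<lambda>q. frechet_derivative f (at q) d) (at p) e"
  have inner: "frechet_derivative (\<lambda>q. g q \<bullet> w) (at q) e = frechet_derivative g (at q) e \<bullet> w"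
    if "smooth_on U g" "q \<in> U" for g :: "'a \<Rightarrow> 'b" and w q e
    using frechet_derivative_bilinear[OF bounded_bilinear_inner that(1) smooth_on_const that(2), of w e]
    by simp
  have "?D d e \<bullet> w = ?D e d \<bullet> w" for w
  proof -
    have "frechet_derivative (\<lambda>q. frechet_derivative (\<lambda>q. f q \<bullet> w) (at q) d) (at p) e = ?D d e \<bullet> w" for d e
    proof -
      have "frechet_derivative (\<lambda>q. frechet_derivative (\<lambda>q. f q \<bullet> w) (at q) d) (at p) =
          frechet_derivative (\<lambda>q. frechet_derivative f (at q) d \<bullet> w) (at p)"
        by (rule frechet_derivative_cong[OF \<open>open U\<close> \<open>p \<in> U\<close>]) (rule inner[OF f])
      then show ?thesis
        using inner[OF smooth_on_frechet_derivative[OF f] \<open>p \<in> U\<close>] by simp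
    qed
    moreover have "smooth_on U (\<lambda>q. f q \<bullet> w)"
      using smooth_on_bilinear[OF bounded_bilinear_inner \<open>open U\<close> f smooth_on_const] .
    ultimately show ?thesis
      using second_derivative_symmetric_real[OF \<open>open U\<close> _ \<open>p \<in> U\<close>, of "\<lambda>q. f q \<bullet> w" d e] by simp
  qed
  then have "(?D d e - ?D e d) \<bullet> (?D d e - ?D e d) = 0"
    by (simp only: inner_diff_left)
  then show ?thesis
    by simp
qed

section \<open>Integrals along segments and joined paths\<close>

text \<open>
  The integral is oriented, so \<open>b < a\<close> is covered, and the derivative is two-sided: by compactness,
  the segment from \<open>a\<close> to \<open>b\<close> can be prolonged a little at both ends within \<open>S\<close>.
\<close>
lemma LBINT_has_vector_derivative_endpoint:
  fixes f :: "real \<Rightarrow> real"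
  assumes "open S" "closed_segment a b \<subseteq> S" "continuous_on S f"
  shows "((\<lambda>r. LBINT y=a..r. f y) has_vector_derivative f b) (at b)"
proof -
  obtain \<epsilon> where "\<epsilon> > 0" and \<epsilon>: "(\<Union>x\<in>closed_segment a b. cball x \<epsilon>) \<subseteq> S"
    using compact_subset_open_imp_cball_epsilon_subset[OF compact_segment assms(1,2)] by blast
  have "{min a b - \<epsilon>..max a b + \<epsilon>} \<subseteq> (\<Union>x\<in>closed_segment a b. cball x \<epsilon>)"
  proof
    fix y assume "y \<in> {min a b - \<epsilon>..max a b + \<epsilon>}"
    \<comment> \<open>The witness is the point of the segment nearest to \<open>y\<close>.\<close>
    then have "max (min a b) (min y (max a b)) \<in> closed_segment a b"
      "y \<in> cball (max (min a b) (min y (max a b))) \<epsilon>"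
      using \<open>\<epsilon> > 0\<close> by (auto simp: closed_segment_eq_real_ivl dist_real_def min_def max_def)
    then show "y \<in> (\<Union>x\<in>closed_segment a b. cball x \<epsilon>)" by blast
  qed
  from this \<epsilon> have "continuous_on {min a b - \<epsilon>..max a b + \<epsilon>} f"
    by (rule continuous_on_subset[OF assms(3) subset_trans])
  then have "((\<lambda>r. LBINT y=a..r. f y) has_vector_derivative f b)
      (at b within {min a b - \<epsilon>..max a b + \<epsilon>})"
    using \<open>\<epsilon> > 0\<close> by (intro interval_integral_FTC2) auto
  moreover have "at b within {min a b - \<epsilon>..max a b + \<epsilon>} = at b"
    using \<open>\<epsilon> > 0\<close> by (intro at_within_interior) (auto simp: min_def max_def)
  ultimately show ?thesis by simp
qed

text \<open>
  Additivity of the integral of a form \<open>\<omega>\<close> over the concatenation of two paths.  Concatenation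
  runs through each path at double speed in half the time, and homogeneity of \<open>\<omega>\<close> in the tangent
  vector makes the two effects cancel.
\<close>
lemma has_integral_join:
  fixes \<omega> :: "'a::real_normed_vector \<Rightarrow> 'a \<Rightarrow> real"
  assumes g1: "\<And>r. (g1 has_vector_derivative d1 r) (at r)"
    and g2: "\<And>r. (g2 has_vector_derivative d2 r) (at r)"
    and scale: "\<And>p h c. \<omega> p (c *\<^sub>R h) = c * \<omega> p h"
    and I1: "((\<lambda>r. \<omega> (g1 r) (d1 r)) has_integral i1) {0..1}"
    and I2: "((\<lambda>r. \<omega> (g2 r) (d2 r)) has_integral i2) {0..1}"
  shows "((\<lambda>r. \<omega> ((g1 +++ g2) r) (vector_derivative (g1 +++ g2) (at r))) has_integral i1 + i2) {0..1}"
proof (rule has_integral_combine[of 0 "1/2" 1])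
  let ?g = "g1 +++ g2"
  have "vector_derivative ?g (at r) = 2 *\<^sub>R d1 (2 * r)" if "r < 1/2" for r
  proof (rule vector_derivative_at, rule has_vector_derivative_transform_within_open)
    show "((\<lambda>r. g1 (2 * r)) has_vector_derivative 2 *\<^sub>R d1 (2 * r)) (at r)"
      by (rule vector_diff_chain_at[OF _ g1, unfolded o_def])
        (auto intro!: derivative_eq_intros)
    show "open {..<1/2::real}" by simp
  qed (use that in \<open>auto simp: joinpaths_def\<close>)
  then have eq: "2 * \<omega> (g1 (2 * r)) (d1 (2 * r)) = \<omega> (?g r) (vector_derivative ?g (at r))"
    if "r < 1/2" for r
    using that by (simp add: joinpaths_def scale)
  have "((\<lambda>r. 2 * \<omega> (g1 (2 * r)) (d1 (2 * r))) has_integral i1) {0..1/2}"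
    using has_integral_affinity01[OF I1, of 2 0, THEN has_integral_cmul[where c = 2]]
    by (simp_all only: image_affinity_atLeastAtMost_div_diff) simp
  then show "((\<lambda>r. \<omega> (?g r) (vector_derivative ?g (at r))) has_integral i1) {0..1/2}"
    by (rule has_integral_spike_finite[of "{1/2}", rotated 2]) (auto simp: eq)
  have "vector_derivative ?g (at r) = 2 *\<^sub>R d2 (2 * r - 1)" if "r > 1/2" for r
  proof (rule vector_derivative_at, rule has_vector_derivative_transform_within_open)
    show "((\<lambda>r. g2 (2 * r - 1)) has_vector_derivative 2 *\<^sub>R d2 (2 * r - 1)) (at r)"
      by (rule vector_diff_chain_at[OF _ g2, unfolded o_def])
        (auto intro!: derivative_eq_intros)
    show "open {1/2::real<..}" by simp
  qed (use that in \<open>auto simp: joinpaths_def\<close>)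
  then have eq: "2 * \<omega> (g2 (2 * r - 1)) (d2 (2 * r - 1)) = \<omega> (?g r) (vector_derivative ?g (at r))"
    if "r > 1/2" for r
    using that by (simp add: joinpaths_def scale)
  have "((\<lambda>r. 2 * \<omega> (g2 (2 * r - 1)) (d2 (2 * r - 1))) has_integral i2) {1/2..1}"
    using has_integral_affinity01[OF I2, of 2 "-1", THEN has_integral_cmul[where c = 2]]
    by (simp_all only: image_affinity_atLeastAtMost_div_diff) simp
  then show "((\<lambda>r. \<omega> (?g r) (vector_derivative ?g (at r))) has_integral i2) {1/2..1}"
    by (rule has_integral_spike_finite[of "{1/2}", rotated 2]) (auto simp: eq)
qed auto

lemma polynomial_function_has_vector_derivative:
  fixes g :: "real \<Rightarrow> 'a::euclidean_space"
  assumes "polynomial_function g"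
  obtains d where "\<And>r. (g has_vector_derivative d r) (at r)" "continuous_on UNIV d" "valid_path g"
proof -
  obtain d where d: "polynomial_function d" "\<And>r. (g has_vector_derivative d r) (at r)"
    using has_vector_derivative_polynomial_function[OF assms] by blast
  moreover have "valid_path g"
    using d unfolding valid_path_def
    by (intro C1_differentiable_imp_piecewise)
      (auto simp: C1_differentiable_on_def intro: continuous_on_polymonial_function)
  ultimately show thesis
    using that continuous_on_polymonial_function by blast
qed

text \<open>
  A compact segment in \<open>U\<close> has a uniform neighbourhood in \<open>U\<close>, and moving the end points by less
  than \<open>\<epsilon>\<close> moves each point of the segment by less than \<open>\<epsilon>\<close>.  This gives the openness of the set of
  points that an L-shaped path reaches inside \<open>U\<close>.
\<close>
lemma open_closed_segment_subset:
  fixes U :: "'a::real_normed_vector set"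
  assumes "open U"
  shows "open {(a, b). closed_segment a b \<subseteq> U}"
  unfolding open_dist
proof safe
  fix a b :: 'a assume "closed_segment a b \<subseteq> U"
  then obtain \<epsilon> where "\<epsilon> > 0" and \<epsilon>: "(\<Union>x\<in>closed_segment a b. ball x \<epsilon>) \<subseteq> U"
    using compact_subset_open_imp_ball_epsilon_subset[OF compact_segment assms] by blast
  have "closed_segment a' b' \<subseteq> U" if d: "dist (a', b') (a, b) < \<epsilon>" for a' b'
  proof
    fix y assume "y \<in> closed_segment a' b'"
    then obtain t where t: "0 \<le> t" "t \<le> 1" "y = (1 - t) *\<^sub>R a' + t *\<^sub>R b'"
      by (auto simp: closed_segment_def)
    have ab: "norm (a' - a) < \<epsilon>" "norm (b' - b) < \<epsilon>"
      using le_less_trans[OF dist_fst_le d] le_less_trans[OF dist_snd_le d]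
      by (auto simp: dist_norm)
    let ?z = "(1 - t) *\<^sub>R a + t *\<^sub>R b"
    have "y - ?z = (1 - t) *\<^sub>R (a' - a) + t *\<^sub>R (b' - b)"
      by (simp add: t algebra_simps)
    also have "norm \<dots> \<le> (1 - t) * norm (a' - a) + t * norm (b' - b)"
      using t by (metis norm_triangle_ineq norm_scaleR abs_of_nonneg diff_ge_0_iff_ge)
    also have "\<dots> < \<epsilon>"
      using ab t by (intro convex_bound_lt) auto
    finally have "y \<in> ball ?z \<epsilon>"
      by (simp add: dist_norm norm_minus_commute)
    moreover have "?z \<in> closed_segment a b"
      using t by (auto simp: closed_segment_def)
    ultimately show "y \<in> U" using \<epsilon> by blast
  qed
  then show "\<exists>e>0. \<forall>y. dist y (a, b) < e \<longrightarrow> y \<in> {(a, b). closed_segment a b \<subseteq> U}"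
    using \<open>\<epsilon> > 0\<close> by force
qed

section \<open>From a primitive to its integral form\<close>

lemma closed_segment_horizontal:
  assumes "r \<in> closed_segment a (b :: real)"
  shows "(r, v :: real) \<in> closed_segment (a, v) (b, v)"
  using assms by (force simp: closed_segment_def algebra_simps)

lemma closed_segment_vertical:
  assumes "r \<in> closed_segment a (b :: real)"
  shows "(u :: real, r) \<in> closed_segment (u, a) (u, b)"
  using assms by (force simp: closed_segment_def algebra_simps)

lemma has_vector_derivative_along_path:
  assumes "(\<gamma> has_vector_derivative d) (at r)" "(f has_derivative L) (at (\<gamma> r))"
  shows "((\<lambda>r. f (\<gamma> r)) has_vector_derivative L d) (at r)"
  using vector_derivative_diff_chain_within[OF assms(1), of f L, unfolded o_def]
    has_derivative_at_withinI[OF assms(2)] by simp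

text \<open>
  Both cases of the integral form are the fundamental theorem of calculus for \<open>l\<close>: along the two
  legs of the L-shaped path, or along an arbitrary path.  In the second case the strong form of the
  theorem, with finitely many exceptional points, is what makes piecewise \<open>C\<^sup>1\<close> paths admissible
  without a bound on their speed near the breakpoints.
\<close>
lemma has_integral_form_of_primitive:
  assumes "continuous_on U a1" "continuous_on U a2"
    and dl: "\<And>p. p \<in> U \<Longrightarrow> (l has_derivative (\<lambda>h. - (a1 p * fst h + a2 p * snd h))) (at p)"
  shows "has_integral_form U a1 a2 u0 v0 (l (u0, v0)) l"
  unfolding has_integral_form_def
proof (intro allI impI)
  fix u v assume "(u, v) \<in> U"
  have hor: "((\<lambda>r. - l (r, v)) has_vector_derivative a1 (r, v)) (at r)" if "(r, v) \<in> U" for r v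
  proof -
    have "((\<lambda>r. (r, v)) has_vector_derivative (1, 0)) (at r)"
      by (auto intro!: derivative_eq_intros has_vector_derivative_Pair)
    from has_vector_derivative_along_path[OF this dl[OF that]] show ?thesis
      by (auto intro!: derivative_eq_intros)
  qed
  have ver: "((\<lambda>r. - l (u, r)) has_vector_derivative a2 (u, r)) (at r)" if "(u, r) \<in> U" for r u
  proof -
    have "((\<lambda>r. (u, r)) has_vector_derivative (0, 1)) (at r)"
      by (auto intro!: derivative_eq_intros has_vector_derivative_Pair)
    from has_vector_derivative_along_path[OF this dl[OF that]] show ?thesis
      by (auto intro!: derivative_eq_intros)
  qed
  show "if closed_segment (u0, v0) (u0, v) \<union> closed_segment (u0, v) (u, v) \<subseteq> U
      then l (u, v) = - ((LBINT r=u0..u. a1 (r, v)) + (LBINT r=v0..v. a2 (u0, r))) + l (u0, v0)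
      else \<forall>\<gamma>. valid_path \<gamma> \<and> path_image \<gamma> \<subseteq> U \<and> pathstart \<gamma> = (u0, v0) \<and> pathfinish \<gamma> = (u, v) \<longrightarrow>
        l (u, v) = - line_integral a1 a2 \<gamma> + l (u0, v0)"
  proof (simp only: if_bool_eq_conj, intro conjI impI allI)
    assume L: "closed_segment (u0, v0) (u0, v) \<union> closed_segment (u0, v) (u, v) \<subseteq> U"
    have ivl: "r \<in> closed_segment a b" if "min a b \<le> r" "r \<le> max a b" for r a b :: real
      using that by (auto simp: closed_segment_eq_real_ivl)
    have seg: "(r, v) \<in> U" if "min u0 u \<le> r" "r \<le> max u0 u" for r
      using closed_segment_horizontal[OF ivl[OF that]] L by blast
    have "(LBINT r=u0..u. a1 (r, v)) = - l (u, v) - - l (u0, v)"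
      by (rule interval_integral_FTC_finite[of u0 u "\<lambda>r. a1 (r, v)" "\<lambda>r. - l (r, v)"])
        (auto intro!: continuous_on_compose2[OF assms(1)] continuous_intros seg has_vector_derivative_at_within[OF hor])
    moreover have seg: "(u0, r) \<in> U" if "min v0 v \<le> r" "r \<le> max v0 v" for r
      using closed_segment_vertical[OF ivl[OF that]] L by blast
    have "(LBINT r=v0..v. a2 (u0, r)) = - l (u0, v) - - l (u0, v0)"
      by (rule interval_integral_FTC_finite[of v0 v "\<lambda>r. a2 (u0, r)" "\<lambda>r. - l (u0, r)"])
        (auto intro!: continuous_on_compose2[OF assms(2)] continuous_intros seg has_vector_derivative_at_within[OF ver])
    ultimately show "l (u, v) = - ((LBINT r=u0..u. a1 (r, v)) + (LBINT r=v0..v. a2 (u0, r))) + l (u0, v0)"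
      by simp
  next
    fix \<gamma> assume \<gamma>: "valid_path \<gamma> \<and> path_image \<gamma> \<subseteq> U \<and> pathstart \<gamma> = (u0, v0) \<and> pathfinish \<gamma> = (u, v)"
    then obtain S where S: "finite S" "\<gamma> C1_differentiable_on ({0..1} - S)" and "continuous_on {0..1} \<gamma>"
      by (auto simp: valid_path_def piecewise_C1_differentiable_on_def)
    have "((\<lambda>r. - (a1 (\<gamma> r) * fst (vector_derivative \<gamma> (at r)) + a2 (\<gamma> r) * snd (vector_derivative \<gamma> (at r))))
        has_integral l (\<gamma> 1) - l (\<gamma> 0)) {0..1}"
    proof (rule fundamental_theorem_of_calculus_interior_strong[OF S(1)])
      show "continuous_on {0..1} (\<lambda>r. l (\<gamma> r))"
      proof (rule continuous_on_compose2[OF _ \<open>continuous_on {0..1} \<gamma>\<close>])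
        show "continuous_on U l"
          using dl has_derivative_continuous continuous_at_imp_continuous_on by blast
      qed (use \<gamma> in \<open>auto simp: path_image_def\<close>)
      fix r :: real assume r: "r \<in> {0<..<1} - S"
      then have "(\<gamma> has_vector_derivative vector_derivative \<gamma> (at r)) (at r)"
        using S(2) by (auto simp: C1_differentiable_on_eq vector_derivative_works)
      moreover have "\<gamma> r \<in> U"
        using \<gamma> r by (auto simp: path_image_def)
      ultimately show "((\<lambda>r. l (\<gamma> r)) has_vector_derivative
          - (a1 (\<gamma> r) * fst (vector_derivative \<gamma> (at r)) + a2 (\<gamma> r) * snd (vector_derivative \<gamma> (at r)))) (at r)"
        by (rule has_vector_derivative_along_path[OF _ dl])
    qed auto
    then have "- line_integral a1 a2 \<gamma> = l (\<gamma> 1) - l (\<gamma> 0)"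
      unfolding line_integral_def by (simp only: integral_neg[symmetric] integral_unique)
    then show "l (u, v) = - line_integral a1 a2 \<gamma> + l (u0, v0)"
      using \<gamma> by (auto simp: pathstart_def pathfinish_def)
  qed
qed

section \<open>From the integral form to a primitive\<close>

text \<open>
  Fix one polynomial path from \<open>p0\<close> to \<open>p\<close> and append the segment from \<open>p\<close> to \<open>p + h e\<close>.  Only the
  contribution of the segment varies with \<open>h\<close>, and it is the one-dimensional integral of the form in
  direction \<open>e\<close>, whose derivative at \<open>h = 0\<close> is given by the fundamental theorem of calculus.
\<close>
lemma line_derivative_of_path_independent:
  assumes "open U" "connected U" "continuous_on U a1" "continuous_on U a2" "p0 \<in> U"
    and "open W" "W \<subseteq> U" "p \<in> W"
    and l: "\<And>q \<gamma>. \<lbrakk>q \<in> W; valid_path \<gamma>; path_image \<gamma> \<subseteq> U; pathstart \<gamma> = p0; pathfinish \<gamma> = q\<rbrakk>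
      \<Longrightarrow> l q = - line_integral a1 a2 \<gamma> + c"
  shows "((\<lambda>h. l (p + h *\<^sub>R e)) has_vector_derivative - (a1 p * fst e + a2 p * snd e)) (at 0)"
proof -
  define \<omega> where "\<omega> = (\<lambda>q h. a1 q * fst h + a2 q * snd h)"
  define \<phi> where "\<phi> = (\<lambda>\<tau>. \<omega> (p + \<tau> *\<^sub>R e) e)"
  define A where "A = (\<lambda>h::real. LBINT \<tau>=ereal 0..h. \<phi> \<tau>)"
  obtain \<gamma> where "polynomial_function \<gamma>" and \<gamma>: "path_image \<gamma> \<subseteq> U" "pathstart \<gamma> = p0" "pathfinish \<gamma> = p"
    using connected_open_polynomial_connected[OF assms(1,2,5), of p] \<open>W \<subseteq> U\<close> \<open>p \<in> W\<close> by blast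
  then obtain d where d: "\<And>r. (\<gamma> has_vector_derivative d r) (at r)" "continuous_on UNIV d" "valid_path \<gamma>"
    using polynomial_function_has_vector_derivative by blast
  define K where "K = integral {0..1} (\<lambda>r. \<omega> (\<gamma> r) (d r))"
  have "continuous_on {0..1} \<gamma>"
    using d(1) by (meson continuous_at_imp_continuous_on has_vector_derivative_continuous)
  then have "continuous_on {0..1} (\<lambda>r. \<omega> (\<gamma> r) (d r))"
    using \<gamma>(1) unfolding \<omega>_def path_image_def
    by (intro continuous_intros continuous_on_compose2[OF assms(3)] continuous_on_compose2[OF assms(4)]
        continuous_on_subset[OF d(2)]) auto
  then have K: "((\<lambda>r. \<omega> (\<gamma> r) (d r)) has_integral K) {0..1}"
    unfolding K_def by (intro integrable_integral integrable_continuous_real)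
  have "open ((\<lambda>\<tau>. p + \<tau> *\<^sub>R e) -` W)"
    using \<open>open W\<close> by (intro open_vimage continuous_intros)
  moreover have "0 \<in> (\<lambda>\<tau>. p + \<tau> *\<^sub>R e) -` W"
    using \<open>p \<in> W\<close> by simp
  ultimately obtain \<delta> where "\<delta> > 0" and "ball 0 \<delta> \<subseteq> (\<lambda>\<tau>. p + \<tau> *\<^sub>R e) -` W"
    by (rule openE)
  then have \<delta>: "p + \<tau> *\<^sub>R e \<in> W" if "\<tau> \<in> ball 0 \<delta>" for \<tau>
    using that by blast
  have cont: "continuous_on (ball 0 \<delta>) \<phi>"
    unfolding \<phi>_def \<omega>_def using \<delta> \<open>W \<subseteq> U\<close>
    by (intro continuous_intros continuous_on_compose2[OF assms(3)] continuous_on_compose2[OF assms(4)]) auto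
  have A: "(A has_vector_derivative \<phi> h) (at h)" if "h \<in> ball 0 \<delta>" for h
    unfolding A_def
  proof (rule LBINT_has_vector_derivative_endpoint[OF open_ball _ cont])
    show "closed_segment 0 h \<subseteq> ball 0 \<delta>"
      using \<open>\<delta> > 0\<close> that by (intro closed_segment_subset convex_ball) auto
  qed
  have l_line: "l (p + h *\<^sub>R e) = - (K + A h) + c" if "h \<in> ball 0 \<delta>" for h
  proof -
    have rh: "r * h \<in> ball 0 \<delta>" if "r \<in> {0..1}" for r
    proof -
      have "r * \<bar>h\<bar> \<le> 1 * \<bar>h\<bar>"
        using that by (intro mult_right_mono) auto
      then show ?thesis
        using \<open>h \<in> ball 0 \<delta>\<close> that by (simp add: abs_mult)
    qed
    let ?g = "linepath p (p + h *\<^sub>R e)"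
    have g: "?g r = p + (r * h) *\<^sub>R e" for r
      by (simp add: linepath_def algebra_simps)
    have g_deriv: "(?g has_vector_derivative h *\<^sub>R e) (at r)" for r
      using has_vector_derivative_linepath_within[of p "p + h *\<^sub>R e" r UNIV] by simp
    have "((\<lambda>r. h *\<^sub>R \<phi> (r * h)) has_integral A (1 * h) - A (0 * h)) {0..1}"
    proof (rule fundamental_theorem_of_calculus)
      fix r :: real assume "r \<in> {0..1}"
      have "((\<lambda>r. r * h) has_vector_derivative h) (at r)"
        by (auto intro!: derivative_eq_intros simp: has_real_derivative_iff_has_vector_derivative[symmetric])
      from vector_diff_chain_at[OF this A[OF rh[OF \<open>r \<in> {0..1}\<close>]]]
      show "((\<lambda>r. A (r * h)) has_vector_derivative h *\<^sub>R \<phi> (r * h)) (at r within {0..1})"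
        by (simp add: o_def has_vector_derivative_at_within)
    qed simp
    moreover have "A 0 = 0"
      by (simp add: A_def flip: zero_ereal_def)
    ultimately have "((\<lambda>r. \<omega> (?g r) (h *\<^sub>R e)) has_integral A h) {0..1}"
      by (simp add: g \<phi>_def \<omega>_def algebra_simps)
    from has_integral_join[OF d(1) g_deriv _ K this]
    have "((\<lambda>r. \<omega> ((\<gamma> +++ ?g) r) (vector_derivative (\<gamma> +++ ?g) (at r))) has_integral K + A h) {0..1}"
      by (simp add: \<omega>_def algebra_simps)
    then have "line_integral a1 a2 (\<gamma> +++ ?g) = K + A h"
      unfolding line_integral_def \<omega>_def by (rule integral_unique)
    moreover have "path_image ?g \<subseteq> U"
      unfolding path_image_def using g rh \<delta> \<open>W \<subseteq> U\<close> by auto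
    ultimately show ?thesis
      using l[of "p + h *\<^sub>R e" "\<gamma> +++ ?g"] \<gamma> d(3) \<delta>[OF that]
      by (simp add: valid_path_join path_image_join)
  qed
  have "((\<lambda>h. - (K + A h) + c) has_vector_derivative - \<phi> 0) (at 0)"
    using A[of 0] \<open>\<delta> > 0\<close> by (auto intro!: derivative_eq_intros)
  then have "((\<lambda>h. l (p + h *\<^sub>R e)) has_vector_derivative - \<phi> 0) (at 0)"
    by (rule has_vector_derivative_transform_within_open[of _ _ _ "ball 0 \<delta>"])
      (use \<open>\<delta> > 0\<close> l_line in auto)
  then show ?thesis
    by (simp add: \<phi>_def \<omega>_def)
qed

text \<open>
  The integral form is given by L-shaped paths on an open part \<open>R\<close> of \<open>U\<close> and by arbitrary paths on
  the rest.  The equation is proved on \<open>R\<close> and at interior points of \<open>U - R\<close>, and extended by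
  continuity.
\<close>
lemma has_integral_form_imp_derivative:
  assumes "open U" "connected U" and l: "smooth_on U l" and a: "smooth_on U a1" "smooth_on U a2"
    and closed: "\<And>p. p \<in> U \<Longrightarrow> frechet_derivative a1 (at p) (0, 1) = frechet_derivative a2 (at p) (1, 0)"
    and "(u0, v0) \<in> U" and form: "has_integral_form U a1 a2 u0 v0 c l" and "p \<in> U"
  shows "frechet_derivative l (at p) (1, 0) = - a1 p \<and> frechet_derivative l (at p) (0, 1) = - a2 p"
proof -
  let ?l1 = "\<lambda>p. frechet_derivative l (at p) (1, 0)" and ?l2 = "\<lambda>p. frechet_derivative l (at p) (0, 1)"
  note cont = smooth_on_continuous_on[OF a(1)] smooth_on_continuous_on[OF a(2)]
    smooth_on_continuous_on[OF smooth_on_frechet_derivative[OF l]]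
  have hor: "((\<lambda>r. f (r, v)) has_vector_derivative frechet_derivative f (at (r, v)) (1, 0)) (at r)"
    if "smooth_on U f" "(r, v) \<in> U" for f :: "real \<times> real \<Rightarrow> real" and r v
    using smooth_on_line_derivative[of U f "(0, v)" r "(1, 0)"] that by simp
  have ver: "((\<lambda>r. f (u, r)) has_vector_derivative frechet_derivative f (at (u, r)) (0, 1)) (at r)"
    if "smooth_on U f" "(u, r) \<in> U" for f :: "real \<times> real \<Rightarrow> real" and r u
    using smooth_on_line_derivative[of U f "(u, 0)" r "(0, 1)"] that by simp
  define R where "R = {q. closed_segment (u0, v0) (u0, snd q) \<subseteq> U} \<inter> {q. closed_segment (u0, snd q) q \<subseteq> U}"
  have "open R"
  proof -
    have "open ((\<lambda>q. (f q, g q)) -` {(a, b). closed_segment a b \<subseteq> U})"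
      if "continuous_on UNIV f" "continuous_on UNIV g" for f g :: "real \<times> real \<Rightarrow> real \<times> real"
      using that by (intro open_vimage[OF open_closed_segment_subset[OF \<open>open U\<close>]] continuous_intros)
    note op = this
    have "continuous_on UNIV (\<lambda>q :: real \<times> real. (u0, snd q))"
      by (intro continuous_intros)
    with op[of "\<lambda>q. (u0, v0)" "\<lambda>q. (u0, snd q)"] op[of "\<lambda>q. (u0, snd q)" "\<lambda>q. q"] show ?thesis
      unfolding R_def by (intro open_Int) (auto simp: vimage_def)
  qed
  have "R \<subseteq> U"
    unfolding R_def by auto
  have R: "closed_segment (u0, v0) (u0, v) \<union> closed_segment (u0, v) (u, v) \<subseteq> U \<longleftrightarrow> (u, v) \<in> R" for u v
    by (auto simp: R_def)
  have l_R: "l (u, v) = - ((LBINT r=u0..u. a1 (r, v)) + (LBINT r=v0..v. a2 (u0, r))) + c" if "(u, v) \<in> R" for u v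
    using form that \<open>R \<subseteq> U\<close> R[of v u] unfolding has_integral_form_def by (metis subsetD)
  have R_hor: "(r, v) \<in> R" if "(u, v) \<in> R" "r \<in> closed_segment u0 u" for r u v
  proof -
    have "closed_segment (u0, v) (r, v) \<subseteq> closed_segment (u0, v) (u, v)"
      using closed_segment_horizontal[OF that(2), of v] by (simp add: subset_closed_segment)
    with that(1) show ?thesis
      by (auto simp: R_def)
  qed
  have l1_R: "?l1 q = - a1 q" if "q \<in> R" for q
  proof -
    obtain u v where [simp]: "q = (u, v)" by (cases q)
    have op: "open {r. (r, v) \<in> S}" if "open S" for S :: "(real \<times> real) set"
    proof -
      have "open ((\<lambda>r. (r, v)) -` S)"
        using that by (intro open_vimage continuous_intros)
      then show ?thesis
        by (simp add: vimage_def)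
    qed
    have "continuous_on {r. (r, v) \<in> U} (\<lambda>r. a1 (r, v))"
      by (intro continuous_on_compose2[OF cont(1)] continuous_intros) auto
    moreover have "closed_segment u0 u \<subseteq> {r. (r, v) \<in> U}"
      using R_hor[of u v] that \<open>R \<subseteq> U\<close> by auto
    ultimately have "((\<lambda>r. LBINT y=u0..r. a1 (y, v)) has_vector_derivative a1 (u, v)) (at u)"
      by (intro LBINT_has_vector_derivative_endpoint[OF op[OF \<open>open U\<close>]])
    then have "((\<lambda>r. - ((LBINT y=u0..r. a1 (y, v)) + (LBINT y=v0..v. a2 (u0, y))) + c) has_vector_derivative - a1 (u, v)) (at u)"
      by (auto intro!: derivative_eq_intros)
    then have "((\<lambda>r. l (r, v)) has_vector_derivative - a1 (u, v)) (at u)"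
      by (rule has_vector_derivative_transform_within_open[OF _ op[OF \<open>open R\<close>]])
        (use that l_R in auto)
    then show ?thesis
      using vector_derivative_unique_at[OF hor[OF l]] that \<open>R \<subseteq> U\<close> by auto
  qed
  have l2_R: "?l2 q = - a2 q" if "q \<in> R" for q
  proof -
    obtain u v where q: "q = (u, v)" by (cases q)
    have "(u0, v) \<in> R"
      using R_hor[of u v u0] that q by simp
    \<comment> \<open>At the corner, the horizontal integral disappears and \<open>l\<close> is an integral of \<open>a2\<close> alone.\<close>
    have base: "?l2 (u0, v) = - a2 (u0, v)"
    proof -
      have op: "open {r. (u0, r) \<in> S}" if "open S" for S :: "(real \<times> real) set"
    proof -
      have "open ((\<lambda>r. (u0, r)) -` S)"
        using that by (intro open_vimage continuous_intros)
      then show ?thesis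
        by (simp add: vimage_def)
    qed
    have "continuous_on {r. (u0, r) \<in> U} (\<lambda>r. a2 (u0, r))"
        by (intro continuous_on_compose2[OF cont(2)] continuous_intros) auto
      moreover have "closed_segment v0 v \<subseteq> {r. (u0, r) \<in> U}"
        using \<open>(u0, v) \<in> R\<close> closed_segment_vertical[of _ v0 v u0] by (auto simp: R_def)
      ultimately have "((\<lambda>r. LBINT y=v0..r. a2 (u0, y)) has_vector_derivative a2 (u0, v)) (at v)"
        by (intro LBINT_has_vector_derivative_endpoint[OF op[OF \<open>open U\<close>]])
      then have "((\<lambda>r. - (LBINT y=v0..r. a2 (u0, y)) + c) has_vector_derivative - a2 (u0, v)) (at v)"
        by (auto intro!: derivative_eq_intros)
      then have "((\<lambda>r. l (u0, r)) has_vector_derivative - a2 (u0, v)) (at v)"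
        by (rule has_vector_derivative_transform_within_open[OF _ op[OF \<open>open R\<close>]])
          (use \<open>(u0, v) \<in> R\<close> l_R in auto)
      then show ?thesis
        using vector_derivative_unique_at[OF ver[OF l]] \<open>(u0, v) \<in> R\<close> \<open>R \<subseteq> U\<close> by auto
    qed
    have "((\<lambda>r. ?l2 (r, v) + a2 (r, v)) has_vector_derivative 0) (at r within closed_segment u0 u)"
      if "r \<in> closed_segment u0 u" for r
    proof -
      have "(r, v) \<in> R"
        using R_hor that \<open>q \<in> R\<close> q by simp
      then have "(r, v) \<in> U" using \<open>R \<subseteq> U\<close> by auto
      have "frechet_derivative ?l2 (at (r, v)) (1, 0) = frechet_derivative ?l1 (at (r, v)) (0, 1)"
        by (rule second_derivative_symmetric[OF \<open>open U\<close> l \<open>(r, v) \<in> U\<close>])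
      also have "\<dots> = frechet_derivative (\<lambda>q. - a1 q) (at (r, v)) (0, 1)"
        using frechet_derivative_cong[OF \<open>open R\<close> \<open>(r, v) \<in> R\<close>, of ?l1 "\<lambda>q. - a1 q"] l1_R by simp
      also have "\<dots> = - frechet_derivative a2 (at (r, v)) (1, 0)"
        using frechet_derivative_at[OF has_derivative_minus[OF smooth_on_has_derivative[OF a(1) \<open>(r, v) \<in> U\<close>]], symmetric]
          closed[OF \<open>(r, v) \<in> U\<close>] by simp
      finally have eq: "frechet_derivative ?l2 (at (r, v)) (1, 0) = - frechet_derivative a2 (at (r, v)) (1, 0)" .
      have "((\<lambda>r. ?l2 (r, v) + a2 (r, v)) has_vector_derivative
          - frechet_derivative a2 (at (r, v)) (1, 0) + frechet_derivative a2 (at (r, v)) (1, 0)) (at r)"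
        unfolding eq[symmetric]
        by (intro has_vector_derivative_add hor smooth_on_frechet_derivative l a(2) \<open>(r, v) \<in> U\<close>)
      then show ?thesis
        by (simp add: has_vector_derivative_at_within)
    qed
    then obtain k where "\<And>r. r \<in> closed_segment u0 u \<Longrightarrow> ?l2 (r, v) + a2 (r, v) = k"
      using has_vector_derivative_zero_constant[OF convex_closed_segment] by blast
    from this[of u0] this[of u] base show ?thesis
      by (simp add: q)
  qed
  have off_R: "frechet_derivative l (at q) e = - (a1 q * fst e + a2 q * snd e)"
    if W: "open W" "W \<subseteq> U - R" "q \<in> W" for W q e
  proof -
    have "l (u, v) = - line_integral a1 a2 \<gamma> + c"
      if "(u, v) \<in> W" "valid_path \<gamma>" "path_image \<gamma> \<subseteq> U" "pathstart \<gamma> = (u0, v0)" "pathfinish \<gamma> = (u, v)" for u v \<gamma>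
    proof -
      have "(u, v) \<in> U" "\<not> closed_segment (u0, v0) (u0, v) \<union> closed_segment (u0, v) (u, v) \<subseteq> U"
        using R[of v u] that(1) W(2) by blast+
      with form that(2-) show ?thesis
        unfolding has_integral_form_def by presburger
    qed
    then have "((\<lambda>h. l (q + h *\<^sub>R e)) has_vector_derivative - (a1 q * fst e + a2 q * snd e)) (at 0)"
      using W by (intro line_derivative_of_path_independent[OF \<open>open U\<close> \<open>connected U\<close> cont(1,2) \<open>(u0, v0) \<in> U\<close> W(1), of q l c]) auto
    moreover have "((\<lambda>h. l (q + h *\<^sub>R e)) has_vector_derivative frechet_derivative l (at q) e) (at 0)"
      using smooth_on_line_derivative[OF l, of q 0 e] W by auto
    ultimately show ?thesis
      using vector_derivative_unique_at by blast
  qed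
  have extend: "g p = 0"
    if "continuous_on U g" "\<And>q. q \<in> R \<Longrightarrow> g q = 0" and off: "\<And>W q. \<lbrakk>open W; W \<subseteq> U - R; q \<in> W\<rbrakk> \<Longrightarrow> g q = 0"
    for g :: "real \<times> real \<Rightarrow> real"
  proof (rule ccontr)
    \<comment> \<open>This open set misses \<open>R\<close>, so all its points are interior points of \<open>U - R\<close>.\<close>
    let ?W = "U \<inter> g -` (- {0})"
    assume "g p \<noteq> 0"
    moreover have "open ?W"
      by (rule continuous_open_preimage[OF that(1) \<open>open U\<close>]) auto
    moreover have "?W \<subseteq> U - R"
      using that(2) by auto
    ultimately show False
      using off[of ?W p] \<open>p \<in> U\<close> by auto
  qed
  have "?l1 p + a1 p = 0"
    by (rule extend) (use l1_R off_R cont in \<open>auto intro!: continuous_intros\<close>)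
  moreover have "?l2 p + a2 p = 0"
    by (rule extend) (use l2_R off_R cont in \<open>auto intro!: continuous_intros\<close>)
  ultimately show ?thesis by simp
qed

section \<open>Framed surfaces and their mates\<close>

lemma partial_eq_frechet_derivative:
  assumes "smooth_on U f" "p \<in> U"
  shows "partial_u f p = frechet_derivative f (at p) (1, 0)"
    and "partial_v f p = frechet_derivative f (at p) (0, 1)"
proof -
  obtain u v where [simp]: "p = (u, v)" by (cases p)
  show "partial_u f p = frechet_derivative f (at p) (1, 0)"
    using smooth_on_line_derivative[of U f "(0, v)" u "(1, 0)"] assms
    by (simp add: partial_u_def vector_derivative_at)
  show "partial_v f p = frechet_derivative f (at p) (0, 1)"
    using smooth_on_line_derivative[of U f "(u, 0)" v "(0, 1)"] assms
    by (simp add: partial_v_def vector_derivative_at)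
qed

lemma frame_orthonormal:
  assumes "framed_surface U x n s" "p \<in> U"
  shows "n p \<bullet> n p = 1" "s p \<bullet> s p = 1" "n p \<bullet> s p = 0" "s p \<bullet> n p = 0"
    "cross3 (n p) (s p) \<bullet> n p = 0" "cross3 (n p) (s p) \<bullet> s p = 0"
    "n p \<bullet> cross3 (n p) (s p) = 0" "s p \<bullet> cross3 (n p) (s p) = 0"
    "cross3 (n p) (s p) \<bullet> cross3 (n p) (s p) = 1"
proof -
  show *: "n p \<bullet> n p = 1" "s p \<bullet> s p = 1" "n p \<bullet> s p = 0" "s p \<bullet> n p = 0"
    using assms by (auto simp: framed_surface_def Delta_def dot_square_norm inner_commute)
  show "cross3 (n p) (s p) \<bullet> cross3 (n p) (s p) = 1"
    by (simp add: dot_cross *)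
qed (simp_all add: dot_cross_self)

lemma frame_derivatives:
  assumes F: "framed_surface U x n s"
    and I: "basic_invariants U x n s a1 b1 e1 f1 g1 a2 b2 e2 f2 g2" and "p \<in> U"
  shows "frechet_derivative x (at p) (1, 0) = a1 p *\<^sub>R s p + b1 p *\<^sub>R cross3 (n p) (s p)"
    and "frechet_derivative x (at p) (0, 1) = a2 p *\<^sub>R s p + b2 p *\<^sub>R cross3 (n p) (s p)"
    and "frechet_derivative s (at p) (1, 0) = - e1 p *\<^sub>R n p + g1 p *\<^sub>R cross3 (n p) (s p)"
    and "frechet_derivative s (at p) (0, 1) = - e2 p *\<^sub>R n p + g2 p *\<^sub>R cross3 (n p) (s p)"
proof -
  have sm: "smooth_on U x" "smooth_on U s"
    using F by (auto simp: framed_surface_def)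
  show "frechet_derivative x (at p) (1, 0) = a1 p *\<^sub>R s p + b1 p *\<^sub>R cross3 (n p) (s p)"
    and "frechet_derivative x (at p) (0, 1) = a2 p *\<^sub>R s p + b2 p *\<^sub>R cross3 (n p) (s p)"
    and "frechet_derivative s (at p) (1, 0) = - e1 p *\<^sub>R n p + g1 p *\<^sub>R cross3 (n p) (s p)"
    and "frechet_derivative s (at p) (0, 1) = - e2 p *\<^sub>R n p + g2 p *\<^sub>R cross3 (n p) (s p)"
    using I \<open>p \<in> U\<close>
    unfolding basic_invariants_def frame_equations_def Let_def
      partial_eq_frechet_derivative[OF sm(1) \<open>p \<in> U\<close>, symmetric]
      partial_eq_frechet_derivative[OF sm(2) \<open>p \<in> U\<close>, symmetric]
    by blast+
qed

lemma displaced_derivative: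
  assumes "smooth_on U x" "smooth_on U s" "smooth_on U l" "p \<in> U"
  shows "frechet_derivative (\<lambda>q. x q + l q *\<^sub>R s q) (at p) e =
    frechet_derivative x (at p) e + l p *\<^sub>R frechet_derivative s (at p) e + frechet_derivative l (at p) e *\<^sub>R s p"
  by (subst frechet_derivative_at[OF has_derivative_add[OF smooth_on_has_derivative[OF assms(1,4)]
      has_derivative_scaleR[OF smooth_on_has_derivative[OF assms(3,4)] smooth_on_has_derivative[OF assms(2,4)]]], symmetric])
    simp

text \<open>
  With \<open>y = x + l s\<close>, orthogonality of \<open>s\<close> to \<open>y\<^sub>u\<close> and \<open>y\<^sub>v\<close> reads \<open>a1 + l\<^sub>u = 0\<close> and \<open>a2 + l\<^sub>v = 0\<close>.
  The mate is \<open>(y, s, n)\<close>: \<open>n\<close> is a unit vector orthogonal to \<open>s\<close>.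
\<close>
lemma framed_surface_mate_iff:
  assumes "open U" and F: "framed_surface U x n s"
    and I: "basic_invariants U x n s a1 b1 e1 f1 g1 a2 b2 e2 f2 g2"
    and l: "smooth_on U l"
  shows "(\<exists>x' n' s'. framed_surface U x' n' s' \<and> (\<forall>p\<in>U. x' p = x p + l p *\<^sub>R s p \<and> n' p = s p)) \<longleftrightarrow>
    (\<forall>p\<in>U. frechet_derivative l (at p) (1, 0) = - a1 p \<and> frechet_derivative l (at p) (0, 1) = - a2 p)"
proof -
  let ?y = "\<lambda>p. x p + l p *\<^sub>R s p"
  have sm: "smooth_on U x" "smooth_on U n" "smooth_on U s"
    using F by (auto simp: framed_surface_def)
  have y: "smooth_on U ?y"
    by (intro smooth_on_add smooth_on_bilinear[OF bounded_bilinear_scaleR] assms(1) sm l)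
  have tangent: "partial_u ?y p \<bullet> s p = a1 p + frechet_derivative l (at p) (1, 0)"
      "partial_v ?y p \<bullet> s p = a2 p + frechet_derivative l (at p) (0, 1)" if "p \<in> U" for p
    unfolding partial_eq_frechet_derivative[OF y that] displaced_derivative[OF sm(1,3) l that]
      frame_derivatives[OF F I that]
    by (simp_all add: inner_add_left inner_diff_left frame_orthonormal[OF F that])
  show ?thesis
  proof
    assume "\<exists>x' n' s'. framed_surface U x' n' s' \<and> (\<forall>p\<in>U. x' p = ?y p \<and> n' p = s p)"
    then obtain x' n' s' where F': "framed_surface U x' n' s'" and eq: "\<And>p. p \<in> U \<Longrightarrow> x' p = ?y p" "\<And>p. p \<in> U \<Longrightarrow> n' p = s p"
      by blast
    then have x': "smooth_on U x'"
      by (auto simp: framed_surface_def)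
    have "a1 p + frechet_derivative l (at p) (1, 0) = 0 \<and> a2 p + frechet_derivative l (at p) (0, 1) = 0"
      if "p \<in> U" for p
    proof -
      have "frechet_derivative x' (at p) = frechet_derivative ?y (at p)"
        by (rule frechet_derivative_cong[OF assms(1) that eq(1)])
      then have "partial_u x' p = partial_u ?y p" "partial_v x' p = partial_v ?y p"
        by (simp_all only: partial_eq_frechet_derivative[OF x' that] partial_eq_frechet_derivative[OF y that])
      moreover have "partial_u x' p \<bullet> n' p = 0 \<and> partial_v x' p \<bullet> n' p = 0"
        using F' that by (simp only: framed_surface_def)
      ultimately show ?thesis
        using tangent[OF that] eq(2)[OF that] by simp
    qed
    then show "\<forall>p\<in>U. frechet_derivative l (at p) (1, 0) = - a1 p \<and> frechet_derivative l (at p) (0, 1) = - a2 p"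
      by (simp add: eq_neg_iff_add_eq_0 add.commute)
  next
    assume "\<forall>p\<in>U. frechet_derivative l (at p) (1, 0) = - a1 p \<and> frechet_derivative l (at p) (0, 1) = - a2 p"
    then have "framed_surface U ?y s n"
      using y sm tangent frame_orthonormal[OF F]
      by (auto simp: framed_surface_def Delta_def norm_eq_sqrt_inner)
    then show "\<exists>x' n' s'. framed_surface U x' n' s' \<and> (\<forall>p\<in>U. x' p = ?y p \<and> n' p = s p)"
      by blast
  qed
qed

text \<open>
  The terms with second derivatives of \<open>y\<close> cancel by symmetry; what remains comes from
  differentiating \<open>s\<close>.
\<close>
lemma tangential_component_commutator:
  fixes y s :: "'a::real_normed_vector \<Rightarrow> 'b::real_inner"
  assumes "open U" "smooth_on U y" "smooth_on U s" "p \<in> U"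
  shows "frechet_derivative (\<lambda>q. frechet_derivative y (at q) d \<bullet> s q) (at p) e
      - frechet_derivative (\<lambda>q. frechet_derivative y (at q) e \<bullet> s q) (at p) d =
    frechet_derivative y (at p) d \<bullet> frechet_derivative s (at p) e
      - frechet_derivative y (at p) e \<bullet> frechet_derivative s (at p) d"
  unfolding frechet_derivative_bilinear[OF bounded_bilinear_inner smooth_on_frechet_derivative[OF assms(2)] assms(3,4)]
    second_derivative_symmetric[OF assms(1,2,4), of d e]
  by simp

text \<open>
  As \<open>a1\<close> and \<open>a2\<close> are the \<open>s\<close>-components of \<open>x\<^sub>u\<close> and \<open>x\<^sub>v\<close>, this is the commutator formula for
  \<open>y = x\<close>, evaluated with the structure equations.
\<close>
lemma integrability_condition:
  assumes "open U" and F: "framed_surface U x n s"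
    and I: "basic_invariants U x n s a1 b1 e1 f1 g1 a2 b2 e2 f2 g2" and "p \<in> U"
  shows "frechet_derivative a1 (at p) (0, 1) - frechet_derivative a2 (at p) (1, 0) = b1 p * g2 p - b2 p * g1 p"
proof -
  have sm: "smooth_on U x" "smooth_on U s"
    using F by (auto simp: framed_surface_def)
  have "frechet_derivative a1 (at p) = frechet_derivative (\<lambda>q. frechet_derivative x (at q) (1, 0) \<bullet> s q) (at p)"
    "frechet_derivative a2 (at p) = frechet_derivative (\<lambda>q. frechet_derivative x (at q) (0, 1) \<bullet> s q) (at p)"
    by (rule frechet_derivative_cong[OF assms(1,4)],
        simp add: frame_derivatives[OF F I] inner_add_left inner_diff_left frame_orthonormal[OF F])+
  then show ?thesis
    using tangential_component_commutator[OF assms(1) sm assms(4), of "(1, 0)" "(0, 1)"]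
    by (simp add: frame_derivatives[OF F I assms(4)] inner_add_left inner_add_right inner_diff_left inner_diff_right
        frame_orthonormal[OF F assms(4)])
qed

text \<open>
  The form \<open>a1 du + a2 dv\<close> has the primitive \<open>- l\<close>, so it is closed and the left-hand side of the
  integrability condition vanishes.
\<close>
lemma primitive_imp_invariants_condition:
  assumes "open U" and F: "framed_surface U x n s"
    and I: "basic_invariants U x n s a1 b1 e1 f1 g1 a2 b2 e2 f2 g2"
    and l: "smooth_on U l"
    and dl: "\<And>p. p \<in> U \<Longrightarrow> frechet_derivative l (at p) (1, 0) = - a1 p \<and> frechet_derivative l (at p) (0, 1) = - a2 p"
    and "p \<in> U"
  shows "b1 p * g2 p - b2 p * g1 p = 0"
proof -
  have a: "smooth_on U a1" "smooth_on U a2"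
    using I by (auto simp: basic_invariants_def)
  have neg: "frechet_derivative (\<lambda>q. - f q) (at p) = (\<lambda>h. - frechet_derivative f (at p) h)"
    if "smooth_on U f" for f :: "real \<times> real \<Rightarrow> real"
    by (rule frechet_derivative_at[OF has_derivative_minus[OF smooth_on_has_derivative[OF that \<open>p \<in> U\<close>]], symmetric])
  have "frechet_derivative (\<lambda>q. frechet_derivative l (at q) (1, 0)) (at p) = frechet_derivative (\<lambda>q. - a1 q) (at p)"
    "frechet_derivative (\<lambda>q. frechet_derivative l (at q) (0, 1)) (at p) = frechet_derivative (\<lambda>q. - a2 q) (at p)"
    using dl by (auto intro!: frechet_derivative_cong[OF assms(1) \<open>p \<in> U\<close>])
  then have "frechet_derivative a1 (at p) (0, 1) = frechet_derivative a2 (at p) (1, 0)"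
    using second_derivative_symmetric[OF assms(1) l \<open>p \<in> U\<close>, of "(1, 0)" "(0, 1)"] neg a by simp
  then show ?thesis
    using integrability_condition[OF assms(1) F I \<open>p \<in> U\<close>] by simp
qed

text \<open>
  The total derivative in coordinates, as integration along paths in arbitrary directions requires.
\<close>
lemma has_derivative_of_partials:
  fixes l :: "real \<times> real \<Rightarrow> real"
  assumes "smooth_on U l" "p \<in> U"
  shows "(l has_derivative (\<lambda>h. frechet_derivative l (at p) (1, 0) * fst h + frechet_derivative l (at p) (0, 1) * snd h)) (at p)"
proof -
  note L = smooth_on_has_derivative[OF assms]
  interpret bounded_linear "frechet_derivative l (at p)"
    using L by (rule has_derivative_bounded_linear)
  have "frechet_derivative l (at p) h = frechet_derivative l (at p) (1, 0) * fst h + frechet_derivative l (at p) (0, 1) * snd h"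
    (is "_ = ?R h") for h
  proof -
    have "frechet_derivative l (at p) h = frechet_derivative l (at p) (fst h *\<^sub>R (1, 0) + snd h *\<^sub>R (0, 1))"
      by simp
    then show ?thesis
      by (simp only: add scaleR) simp
  qed
  then have "frechet_derivative l (at p) = ?R"
    by (rule ext)
  then show ?thesis
    by (rule has_derivative_eq_rhs[OF L])
qed

section \<open>Characterisation of Bertrand framed surfaces\<close>

text \<open>
  Both sides express that \<open>- l\<close> is a primitive of \<open>a1 du + a2 dv\<close>.  The condition on the invariants is
  the closedness of this form, which recovering \<open>dl\<close> from integrals along L-shaped paths requires.
\<close>
theorem mate_iff_integral_form:
  assumes "open U" "connected U" "U \<noteq> {}" and F: "framed_surface U x n s"
    and I: "basic_invariants U x n s a1 b1 e1 f1 g1 a2 b2 e2 f2 g2"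
    and l: "smooth_on U l"
  shows "(\<exists>x' n' s'. framed_surface U x' n' s' \<and> (\<forall>p\<in>U. x' p = x p + l p *\<^sub>R s p \<and> n' p = s p)) \<longleftrightarrow>
    (\<forall>p\<in>U. b1 p * g2 p - b2 p * g1 p = 0) \<and>
    (\<exists>u0 v0 c. (u0, v0) \<in> U \<and> has_integral_form U a1 a2 u0 v0 c l)"
  unfolding framed_surface_mate_iff[OF assms(1) F I l]
proof (intro iffI conjI ballI)
  have a: "smooth_on U a1" "smooth_on U a2"
    using I by (auto simp: basic_invariants_def)
  {
    assume dl: "\<forall>p\<in>U. frechet_derivative l (at p) (1, 0) = - a1 p \<and> frechet_derivative l (at p) (0, 1) = - a2 p"
    then show "b1 p * g2 p - b2 p * g1 p = 0" if "p \<in> U" for p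
      using primitive_imp_invariants_condition[OF assms(1) F I l _ that] by blast
    have "(l has_derivative (\<lambda>h. - (a1 p * fst h + a2 p * snd h))) (at p)" if "p \<in> U" for p
      using has_derivative_of_partials[OF l that] dl that by simp
    then have "has_integral_form U a1 a2 u0 v0 (l (u0, v0)) l" for u0 v0
      by (intro has_integral_form_of_primitive smooth_on_continuous_on a)
    with \<open>U \<noteq> {}\<close> show "\<exists>u0 v0 c. (u0, v0) \<in> U \<and> has_integral_form U a1 a2 u0 v0 c l"
      by fast
  }
  fix p assume *: "(\<forall>p\<in>U. b1 p * g2 p - b2 p * g1 p = 0) \<and>
    (\<exists>u0 v0 c. (u0, v0) \<in> U \<and> has_integral_form U a1 a2 u0 v0 c l)" and "p \<in> U"
  then obtain u0 v0 c where form: "(u0, v0) \<in> U" "has_integral_form U a1 a2 u0 v0 c l"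
    by blast
  have closed: "frechet_derivative a1 (at q) (0, 1) = frechet_derivative a2 (at q) (1, 0)" if "q \<in> U" for q
    using integrability_condition[OF assms(1) F I that] * that by simp
  from has_integral_form_imp_derivative[OF assms(1,2) l a closed form \<open>p \<in> U\<close>]
  show "frechet_derivative l (at p) (1, 0) = - a1 p" "frechet_derivative l (at p) (0, 1) = - a2 p"
    by simp_all
qed

text \<open>
  The displacement function of a pair of mates is exactly an \<open>l\<close> as in the first part, so the
  characterisation of Bertrand surfaces is the first part with \<open>l\<close> quantified existentially.
\<close>
theorem theorem3p12:
  fixes U :: "(real \<times> real) set"
    and x n s :: "real \<times> real \<Rightarrow> real^3"
    and a1 b1 e1 f1 g1 a2 b2 e2 f2 g2 :: "real \<times> real \<Rightarrow> real"
  assumes "open U" and "connected U" and "U \<noteq> {}" and "simply_connected U"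
    and "framed_surface U x n s"
    and "basic_invariants U x n s a1 b1 e1 f1 g1 a2 b2 e2 f2 g2"
  shows "(\<forall>l :: real \<times> real \<Rightarrow> real. smooth_on U l \<and> not_equiv_zero U l \<longrightarrow>
            ((\<exists>x' n' s'. framed_surface U x' n' s' \<and>
                (\<forall>p\<in>U. x' p = x p + l p *\<^sub>R s p \<and> n' p = s p))
             \<longleftrightarrow>
             (\<forall>p\<in>U. b1 p * g2 p - b2 p * g1 p = 0) \<and>
             (\<exists>u0 v0 c. (u0, v0) \<in> U \<and> has_integral_form U a1 a2 u0 v0 c l)))
         \<and>
         (s_n_Bertrand U x n s
          \<longleftrightarrow>
          (\<forall>p\<in>U. b1 p * g2 p - b2 p * g1 p = 0) \<and>
          (\<exists>l :: real \<times> real \<Rightarrow> real. smooth_on U l \<and> not_equiv_zero U l \<and>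
             (\<exists>u0 v0 c. (u0, v0) \<in> U \<and> has_integral_form U a1 a2 u0 v0 c l)))"
proof -
  note mate = mate_iff_integral_form[OF assms(1-3,5,6)]
  have "s_n_Bertrand U x n s \<longleftrightarrow> (\<exists>l. smooth_on U l \<and> not_equiv_zero U l \<and>
      (\<exists>x' n' s'. framed_surface U x' n' s' \<and> (\<forall>p\<in>U. x' p = x p + l p *\<^sub>R s p \<and> n' p = s p)))"
    unfolding s_n_Bertrand_def s_n_mates_def using assms(5) by (auto simp: eq_commute)
  also have "\<dots> \<longleftrightarrow> (\<exists>l. smooth_on U l \<and> not_equiv_zero U l \<and>
      (\<forall>p\<in>U. b1 p * g2 p - b2 p * g1 p = 0) \<and>
      (\<exists>u0 v0 c. (u0, v0) \<in> U \<and> has_integral_form U a1 a2 u0 v0 c l))"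
    using mate by (intro ex_cong1 conj_cong refl) blast
  finally show ?thesis
    using mate by blast
qed

end
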